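(* Assume $q_a=q_r=2$. Let $\omega$ be a non-negative measure on $\mathbb{R}$ with bounded, compactly supported density and total mass $m=\omega(\mathbb{R})>0$, and let $\mu:[0,\infty)\to\mathcal{P}(\mathbb{R})$ be a transient solution (with attraction exponent $q_a$, repulsion exponent $q_r$ and profile $\omega$) with initial datum $\mu_0=\mu(0)$. Then: \begin{itemize} \item If $m>1$, then $\mu(t)$ converges weakly (narrowly), as $t\to\infty$, to the Dirac measure concentrated at the center of mass $\frac1m\int_{\mathbb{R}}x\,d\omega(x)$ of $\omega$. \item If $0<m<1$, then $\mu(t)$ converges vaguely to zero as $t\to\infty$. \item If $m=1$, then for every $t\ge0$ the measure $\mu(t)$ is a translate of $\mu_0$, and the center of mass $\int_{\mathbb{R}}x\,d\mu(t)(x)$ of $\mu(t)$ converges to that of $\omega$ as $t\to\infty$ with exponential rate $\exp(-2mt)$. \end{itemize}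
   Context: Narrow (weak) convergence of finite measures means convergence of integrals against all bounded continuous functions; vague convergence means convergence of integrals against all continuous compactly supported functions. Convergence of $c(t)$ to $c$ with exponential rate $\exp(-2mt)$ means $|c(t)-c|\le C\exp(-2mt)$ for some constant $C$ and all $t\ge0$. $L^\infty_c(\mathbb{R})$ denotes essentially bounded functions with compact support; $\mathcal{P}(\mathbb{R})$ the probability measures on $\mathbb{R}$; $\mathcal{P}_2(\mathbb{R})$ those with finite second moment. For a finite non-negative measure $\nu$ on $\mathbb{R}$ let $F_\nu(x)=\nu((-\infty,x])$ be its CDF and $X_\nu:[0,\nu(\mathbb{R}))\to\mathbb{R}$, $X_\nu(z)=\inf\{x\in\mathbb{R}:F_\nu(x)>z\}$ its pseudo-inverse. $\mathrm{D}([a,b))$ is the Banach space of bounded functions $[a,b)\to\mathbb{R}$ that are right continuous with a left limit at every point, with the sup-norm. Let $q_a,q_r\in[1,2]$, $\psi_a(x)=|x|^{q_a}$, $\psi_r(x)=|x|^{q_r}$, and let $\omega$ be a non-negative measure with density in $L^\infty_c(\mathbb{R})$ and mass $m=\omega(\mathbb{R})>0$; put $G=F_\omega$, $Y=X_\omega$. Transient solution: a map $\mu:[0,\infty)\to\mathcal{P}_2(\mathbb{R})$ such that (i) $\mu(t)$ has a density in $L^\infty_c(\mathbb{R})$ for every $t\ge0$; (ii) $t\mapsto X_{\mu(t)}$ is continuously differentiable from $[0,\infty)$ into $\mathrm{D}([0,1))$; (iii) for every $t\ge0$ and $z\in[0,1)$, $$\partial_tX_{\mu(t)}(z)=-A(t,z)+R(t,z),$$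 where $A(t,z)=\int_0^m\psi_a'(X_{\mu(t)}(z)-Y(\zeta))\,d\zeta$ if $q_a>1$ and $A(t,z)=2G(X_{\mu(t)}(z))-m$ if $q_a=1$; and $R(t,z)=\int_0^1\psi_r'(X_{\mu(t)}(z)-X_{\mu(t)}(\zeta))\,d\zeta$ if $q_r>1$ and $R(t,z)=2z-1$ if $q_r=1$. *)

theory Defs
  imports "HOL-Probability.Probability"
begin

section \<open>Densities and pseudo-inverses\<close>

definition Linf_c :: "(real \<Rightarrow> real) set" where
  "Linf_c = {f \<in> borel_measurable lborel.
     (\<exists>C. AE x in lborel. \<bar>f x\<bar> \<le> C) \<and>
     (\<exists>K. compact K \<and> (AE x in lborel. x \<notin> K \<longrightarrow> f x = 0))}"

text \<open>The non-negativity clause is needed because \<^const>\<open>ennreal\<close> truncates negative values.\<close>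

definition has_Linf_c_density :: "real measure \<Rightarrow> bool" where
  "has_Linf_c_density \<nu> \<longleftrightarrow>
     (\<exists>f \<in> Linf_c. (AE x in lborel. 0 \<le> f x) \<and> \<nu> = density lborel (\<lambda>x. ennreal (f x)))"

definition P2 :: "real measure set" where
  "P2 = {\<nu>. real_distribution \<nu> \<and> integrable \<nu> (\<lambda>x. x\<^sup>2)}"

text \<open>Only the values at \<open>0 \<le> z < \<nu>(\<real>)\<close> are meaningful.\<close>

definition pseudo_inverse :: "real measure \<Rightarrow> real \<Rightarrow> real" where
  "pseudo_inverse \<nu> z = Inf {x. cdf \<nu> x > z}"

section \<open>Continuously differentiable curves in the space of cadlag functions\<close>

text \<open>
  An element of \<open>D([a,b))\<close> is represented by a total function of which only the values on
  \<open>[a,b)\<close> matter. The filter \<open>at_left a\<close> would see values outside the domain, so the (vacuous)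
  left limit at \<open>a\<close> is omitted.
\<close>

definition cadlag :: "real \<Rightarrow> real \<Rightarrow> (real \<Rightarrow> real) set" where
  "cadlag a b = {f. bounded (f ` {a..<b}) \<and>
     (\<forall>x\<in>{a..<b}. (f \<longlongrightarrow> f x) (at_right x)) \<and>
     (\<forall>x\<in>{a<..<b}. \<exists>l. (f \<longlongrightarrow> l) (at_left x))}"

text \<open>
  Convergence in the sup-norm of \<open>D([a,b))\<close> is uniform convergence on \<open>[a,b)\<close>: the first limit
  says that \<open>u' t\<close> is the (at \<open>t = 0\<close> one-sided) derivative of \<open>u\<close> at \<open>t\<close> in that norm, the
  second that \<open>u'\<close> is continuous at \<open>t\<close>.
\<close>

definition C1_into_cadlag :: "real \<Rightarrow> real \<Rightarrow> (real \<Rightarrow> real \<Rightarrow> real) \<Rightarrow> bool" where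
  "C1_into_cadlag a b u \<longleftrightarrow> (\<forall>t\<ge>0. u t \<in> cadlag a b) \<and>
     (\<exists>u'. \<forall>t\<ge>0. u' t \<in> cadlag a b \<and>
        uniform_limit {a..<b} (\<lambda>s z. (u s z - u t z) / (s - t)) (u' t) (at t within {0..}) \<and>
        uniform_limit {a..<b} u' (u' t) (at t within {0..}))"

section \<open>Transient solutions\<close>

definition psi :: "real \<Rightarrow> real \<Rightarrow> real" where
  "psi q x = \<bar>x\<bar> powr q"

definition attraction :: "real \<Rightarrow> real measure \<Rightarrow> real measure \<Rightarrow> real \<Rightarrow> real" where
  "attraction qa \<omega> \<nu> z =
     (let m = measure \<omega> UNIV in
      if qa > 1
      then LINT \<zeta>:{0..<m}|lborel. deriv (psi qa) (pseudo_inverse \<nu> z - pseudo_inverse \<omega> \<zeta>)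
      else 2 * cdf \<omega> (pseudo_inverse \<nu> z) - m)"

definition repulsion :: "real \<Rightarrow> real measure \<Rightarrow> real \<Rightarrow> real" where
  "repulsion qr \<nu> z =
     (if qr > 1
      then LINT \<zeta>:{0..<1}|lborel. deriv (psi qr) (pseudo_inverse \<nu> z - pseudo_inverse \<nu> \<zeta>)
      else 2 * z - 1)"

text \<open>Only the values \<open>\<mu> t\<close> with \<open>t \<ge> 0\<close> matter. The exponents are meant to lie in \<open>[1,2]\<close>.\<close>

definition transient_solution ::
  "real \<Rightarrow> real \<Rightarrow> real measure \<Rightarrow> (real \<Rightarrow> real measure) \<Rightarrow> bool" where
  "transient_solution qa qr \<omega> \<mu> \<longleftrightarrow>
     (\<forall>t\<ge>0. \<mu> t \<in> P2) \<and>
     (\<forall>t\<ge>0. has_Linf_c_density (\<mu> t)) \<and>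
     C1_into_cadlag 0 1 (\<lambda>t. pseudo_inverse (\<mu> t)) \<and>
     (\<forall>t\<ge>0. \<forall>z\<in>{0..<1}.
        ((\<lambda>s. pseudo_inverse (\<mu> s) z) has_real_derivative
           (- attraction qa \<omega> (\<mu> t) z + repulsion qr (\<mu> t) z)) (at t within {0..}))"

section \<open>Convergence of finite measures\<close>

definition narrow_limit :: "('i \<Rightarrow> real measure) \<Rightarrow> real measure \<Rightarrow> 'i filter \<Rightarrow> bool" where
  "narrow_limit \<mu> \<nu> F \<longleftrightarrow>
     (\<forall>f :: real \<Rightarrow> real. continuous_on UNIV f \<and> bounded (range f) \<longrightarrow>
        ((\<lambda>t. \<integral>x. f x \<partial>\<mu> t) \<longlongrightarrow> (\<integral>x. f x \<partial>\<nu>)) F)"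

definition vague_limit :: "('i \<Rightarrow> real measure) \<Rightarrow> real measure \<Rightarrow> 'i filter \<Rightarrow> bool" where
  "vague_limit \<mu> \<nu> F \<longleftrightarrow>
     (\<forall>f :: real \<Rightarrow> real. continuous_on UNIV f \<and> (\<exists>K. compact K \<and> (\<forall>x. x \<notin> K \<longrightarrow> f x = 0)) \<longrightarrow>
        ((\<lambda>t. \<integral>x. f x \<partial>\<mu> t) \<longlongrightarrow> (\<integral>x. f x \<partial>\<nu>)) F)"

definition is_translate :: "real measure \<Rightarrow> real measure \<Rightarrow> bool" where
  "is_translate \<nu> \<nu>0 \<longleftrightarrow> (\<exists>c. \<nu> = distr \<nu>0 borel (\<lambda>x. x + c))"

end

theory Submission
  imports Defs
begin

text \<open>
  For the quadratic exponents the equation for \<open>X\<^sub>t\<close>, the pseudo-inverse of \<open>\<mu> t\<close>, reads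
  \<open>\<partial>\<^sub>t X\<^sub>t z = - 2 (m - 1) X\<^sub>t z + 2 b - 2 M t\<close>, where \<open>b\<close> and \<open>M t\<close> are the first moments of \<open>\<omega>\<close>
  and \<open>\<mu> t\<close>. Differences \<open>X\<^sub>t z - X\<^sub>t w\<close> solve \<open>y' = - 2 (m - 1) y\<close>; integrating over \<open>z\<close> shows
  that \<open>M - b / m\<close> solves \<open>y' = - 2 m y\<close>. Therefore \<open>\<mu> t\<close> is the image of \<open>\<mu> 0\<close> under the affine map
  \<open>x \<mapsto> M t + exp (- 2 (m - 1) t) (x - M 0)\<close>, a translation if \<open>m = 1\<close>. As \<open>t\<close> tends to
  infinity it tends pointwise to \<open>b / m\<close> if \<open>m > 1\<close>, and if \<open>m < 1\<close> it expels every point but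
  \<open>M 0\<close>, which \<open>\<mu> 0\<close> does not charge; dominated convergence gives the two limits.
\<close>

text \<open>The integrating factor \<open>exp (k * t)\<close> turns \<open>y\<close> into a function
  with zero derivative on the convex set \<open>{0..}\<close>. The derivative is taken within
  \<open>{0..}\<close> to match the one-sided derivative at time 0, and \<open>k\<close> may have
  either sign.\<close>

lemma linear_ode_solution:
  fixes y :: "real \<Rightarrow> real"
  assumes ode: "\<And>t. t \<ge> 0 \<Longrightarrow> (y has_real_derivative - k * y t) (at t within {0..})"
    and t: "t \<ge> 0"
  shows "y t = exp (- k * t) * y 0"
proof -
  have "\<exists>c. \<forall>t\<in>{0..}. y t * exp (k * t) = c"
  proof (rule has_field_derivative_zero_constant)
    fix s :: real assume "s \<in> {0..}"
    then show "((\<lambda>t. y t * exp (k * t)) has_real_derivative 0) (at s within {0..})"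
      by (auto intro!: derivative_eq_intros ode simp: algebra_simps)
  qed simp
  then obtain c where c: "\<And>t. t \<ge> 0 \<Longrightarrow> y t * exp (k * t) = c"
    by auto
  have "y t * exp (k * t) = y 0"
    using c[of 0] c[OF t] by simp
  then show ?thesis
    by (auto simp: exp_minus field_simps)
qed

lemma deriv_psi_2: "deriv (psi 2) x = 2 * x"
proof -
  have "psi 2 = (\<lambda>x. x\<^sup>2)"
    by (simp add: psi_def fun_eq_iff)
  moreover have "((\<lambda>x::real. x\<^sup>2) has_real_derivative 2 * x) (at x)"
    by (auto intro!: derivative_eq_intros)
  ultimately show ?thesis
    by (simp add: DERIV_imp_deriv)
qed

subsection \<open>Measures with bounded, compactly supported density\<close>

text \<open>A continuous \<open>g\<close> is bounded on the compact set \<open>K\<close> carrying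
  \<open>f\<close>, so the product is dominated almost everywhere by a multiple of the indicator of
  \<open>K\<close>. Taking \<open>g\<close> to be 1 or the identity gives finite mass and a finite
  first moment.\<close>

lemma Linf_c_integrable_mult:
  assumes f: "f \<in> Linf_c" and g: "continuous_on UNIV g"
  shows "integrable lborel (\<lambda>x. f x * g x)"
proof -
  obtain C K where fm: "f \<in> borel_measurable lborel" and C: "AE x in lborel. \<bar>f x\<bar> \<le> C"
    and K: "compact K" and supp: "AE x in lborel. x \<notin> K \<longrightarrow> f x = 0"
    using f unfolding Linf_c_def by blast
  have gm: "g \<in> borel_measurable lborel"
    using borel_measurable_continuous_onI[OF g] by simp
  have "compact (g ` K)"
    using g K compact_continuous_image continuous_on_subset by blast
  then have "\<exists>B. \<forall>x\<in>K. \<bar>g x\<bar> \<le> B"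
    by (auto dest!: compact_imp_bounded simp: bounded_iff)
  then obtain B where B: "\<And>x. x \<in> K \<Longrightarrow> \<bar>g x\<bar> \<le> B"
    by blast
  have "integrable lborel (\<lambda>x. indicator K x * \<bar>C * B\<bar>)"
    using K emeasure_bounded_finite[OF compact_imp_bounded[OF K]]
    by (intro integrable_mult_left integrable_real_indicator) (auto simp: compact_imp_closed)
  moreover have "AE x in lborel. norm (f x * g x) \<le> norm (indicator K x * \<bar>C * B\<bar>)"
    using C supp
  proof eventually_elim
    case (elim x)
    show ?case
    proof (cases "x \<in> K")
      case True
      have "\<bar>f x\<bar> * \<bar>g x\<bar> \<le> C * B"
        by (rule mult_mono) (use elim(1) B[OF True] abs_ge_zero[of "f x"] in linarith)+
      also have "\<dots> \<le> \<bar>C * B\<bar>" by simp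
      finally show ?thesis using True by (simp add: abs_mult)
    qed (use elim in auto)
  qed
  ultimately show ?thesis
    by (rule Bochner_Integration.integrable_bound[OF _ borel_measurable_times[OF fm gm]])
qed

text \<open>The first two facts make the transport results below applicable to
  \<open>\<omega>\<close> and to each \<open>\<mu> t\<close>; the third, inherited from Lebesgue
  measure, discards the fixed point of the expanding flow when \<open>m < 1\<close>.\<close>

lemma has_Linf_c_density_imp:
  assumes "has_Linf_c_density \<nu>"
  shows has_Linf_c_density_imp_finite: "finite_borel_measure \<nu>"
    and has_Linf_c_density_imp_integrable: "integrable \<nu> (\<lambda>x. x)"
    and has_Linf_c_density_imp_diffuse: "AE x in \<nu>. x \<noteq> c"
proof -
  obtain f where f: "f \<in> Linf_c" and pos: "AE x in lborel. 0 \<le> f x"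
    and \<nu>: "\<nu> = density lborel (\<lambda>x. ennreal (f x))"
    using assms unfolding has_Linf_c_density_def by blast
  have fm: "f \<in> borel_measurable lborel"
    using f unfolding Linf_c_def by blast
  have "integrable lborel (\<lambda>x. f x * 1)"
    by (rule Linf_c_integrable_mult[OF f]) simp
  then have "(\<integral>\<^sup>+x. ennreal (f x) \<partial>lborel) = ennreal (\<integral>x. f x \<partial>lborel)"
    using pos by (intro nn_integral_eq_integral) simp_all
  then have "emeasure \<nu> (space \<nu>) \<noteq> \<infinity>"
    using fm by (simp add: \<nu> emeasure_density)
  then show "finite_borel_measure \<nu>"
    by (intro finite_borel_measure.intro finite_borel_measure_axioms.intro finite_measureI)
       (simp_all add: \<nu>)
  have "integrable lborel (\<lambda>x. f x * x)"
    by (rule Linf_c_integrable_mult[OF f]) simp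
  then show "integrable \<nu> (\<lambda>x. x)"
    using fm pos by (simp add: \<nu> integrable_density)
  show "AE x in \<nu>. x \<noteq> c"
    unfolding \<nu> using fm AE_lborel_singleton[of c] by (subst AE_density) auto
qed

subsection \<open>The pseudo-inverse as a transport map\<close>

context finite_borel_measure
begin

text \<open>\<open>Inf\<close> on the reals is meaningful only for nonempty sets bounded below. The
  level \<open>z = 0\<close> is left out: if the measure charges every left half-line, the set is
  all of the real line there.\<close>

lemma pseudo_inverse_domain:
  assumes z: "0 < z" "z < measure M UNIV"
  shows "{x. cdf M x > z} \<noteq> {}" and "bdd_below {x. cdf M x > z}"
proof -
  have "\<forall>\<^sub>F x in at_top. z < cdf M x"
    using order_tendstoD(1)[OF cdf_lim_at_top] z by (simp add: borel_UNIV)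
  then show "{x. cdf M x > z} \<noteq> {}"
    by (auto dest: eventually_happens)
  have "\<forall>\<^sub>F x in at_bot. cdf M x < z"
    using order_tendstoD(2)[OF cdf_lim_at_bot] z by simp
  then obtain N where N: "\<And>x. x \<le> N \<Longrightarrow> cdf M x < z"
    by (auto simp: eventually_at_bot_linorder)
  show "bdd_below {x. cdf M x > z}"
  proof (rule bdd_belowI[of _ N])
    fix x assume "x \<in> {x. cdf M x > z}"
    then show "N \<le> x" using N[of x] by (cases "x \<le> N") auto
  qed
qed

text \<open>Together with \<open>pseudo_inverse_leD\<close> this compares
  \<open>pseudo_inverse M z \<le> x\<close> with a bound on \<open>z\<close>: strict in one
  direction, weak in the other. The gap is the single level \<open>z = cdf M x\<close>, a Lebesgue
  null set.\<close>

lemma pseudo_inverse_le: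
  assumes "0 < z" "z < cdf M x"
  shows "pseudo_inverse M z \<le> x"
proof -
  have "z < measure M UNIV"
    using assms cdf_bounded[of x] by (simp add: borel_UNIV)
  then show ?thesis
    unfolding pseudo_inverse_def using assms
    by (intro cInf_lower pseudo_inverse_domain) auto
qed

lemma pseudo_inverse_leD:
  assumes z: "0 < z" "z < measure M UNIV" and le: "pseudo_inverse M z \<le> x"
  shows "z \<le> cdf M x"
proof (rule tendsto_lowerbound)
  show "(cdf M \<longlongrightarrow> cdf M x) (at_right x)"
    using cdf_is_right_cont[of x] by (simp add: continuous_within)
  \<comment> \<open>Every \<open>y\<close> to the right of \<open>x\<close> exceeds the infimum, so
    a point of the defining set lies below it; right continuity of the cdf then carries the bound to
    \<open>x\<close> itself.\<close>
  have "z \<le> cdf M y" if "y > x" for y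
  proof -
    have "Inf {x. cdf M x > z} < y"
      using le that by (simp add: pseudo_inverse_def)
    then obtain u where "cdf M u > z" "u < y"
      using cInf_lessD[OF pseudo_inverse_domain(1)[OF z]] by auto
    then show ?thesis
      using cdf_nondecreasing[of u y] by simp
  qed
  then show "\<forall>\<^sub>F y in at_right x. z \<le> cdf M y"
    by (auto simp: eventually_at_filter)
qed simp

lemma mono_on_pseudo_inverse: "mono_on {0<..<measure M UNIV} (pseudo_inverse M)"
proof (rule mono_onI)
  fix r s assume rs: "r \<in> {0<..<measure M UNIV}" "s \<in> {0<..<measure M UNIV}" "r \<le> s"
  then show "pseudo_inverse M r \<le> pseudo_inverse M s"
    unfolding pseudo_inverse_def
    by (intro cInf_superset_mono pseudo_inverse_domain) auto
qed

lemma pseudo_inverse_measurable: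
  "pseudo_inverse M \<in> borel_measurable (restrict_space lborel {0<..<measure M UNIV})"
proof -
  have "sets (restrict_space lborel {0<..<measure M UNIV})
      = sets (restrict_space borel {0<..<measure M UNIV})"
    by (simp add: sets_restrict_space)
  then show ?thesis
    using borel_measurable_mono_on_fnc[OF mono_on_pseudo_inverse] measurable_cong_sets by blast
qed

text \<open>This is inverse transform sampling: the preimage of \<open>{..x}\<close> lies between
  the intervals from 0 to \<open>cdf M x\<close> without and with the right endpoint, so it has
  Lebesgue measure \<open>cdf M x\<close>, and a finite Borel measure is determined by its
  cdf.\<close>

lemma distr_pseudo_inverse:
  "distr (restrict_space lborel {0<..<measure M UNIV}) borel (pseudo_inverse M) = M"
    (is "distr ?L borel ?X = M")
proof (rule cdf_unique')
  let ?m = "measure M UNIV"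
  have L: "finite_measure ?L"
    by (intro finite_measureI) (simp add: space_restrict_space emeasure_restrict_space)
  then interpret D: finite_measure "distr ?L borel ?X"
    by (rule finite_measure.finite_measure_distr) (rule pseudo_inverse_measurable)
  show "finite_borel_measure (distr ?L borel ?X)"
    by unfold_locales simp
  show "finite_borel_measure M" ..
  show "cdf (distr ?L borel ?X) = cdf M"
  proof
    fix x
    let ?A = "?X -` {..x} \<inter> {0<..<?m}"
    have meas: "?A \<in> sets lborel"
      using measurable_sets[OF pseudo_inverse_measurable, of "{..x}"]
      by (simp add: space_restrict_space sets_restrict_space_iff)
    have bound: "cdf M x \<le> ?m" "0 \<le> cdf M x"
      using cdf_bounded[of x] cdf_nonneg by (simp_all add: borel_UNIV)
    have "emeasure ?L ?A = emeasure lborel ?A"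
      by (simp add: emeasure_restrict_space)
    also have "\<dots> = emeasure lborel {0<..<cdf M x}"
    proof (rule antisym)
      have "?A \<subseteq> {0<..cdf M x}"
        using pseudo_inverse_leD by auto
      then have "emeasure lborel ?A \<le> emeasure lborel {0<..cdf M x}"
        by (rule emeasure_mono) simp
      then show "emeasure lborel ?A \<le> emeasure lborel {0<..<cdf M x}"
        using bound by simp
      have "{0<..<cdf M x} \<subseteq> ?A"
        using pseudo_inverse_le bound by auto
      then show "emeasure lborel {0<..<cdf M x} \<le> emeasure lborel ?A"
        by (rule emeasure_mono) (rule meas)
    qed
    also have "\<dots> = ennreal (cdf M x)"
      using bound by simp
    finally have "measure ?L ?A = cdf M x"
      using bound by (simp add: measure_def)
    then show "cdf (distr ?L borel ?X) x = cdf M x"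
      by (simp add: cdf_def[of "distr ?L borel ?X"] measure_distr pseudo_inverse_measurable
          space_restrict_space)
  qed
qed

lemma has_bochner_integral_pseudo_inverse:
  assumes "integrable M (\<lambda>x. x)"
  shows "has_bochner_integral lborel
    (\<lambda>z. indicator {0..<measure M UNIV} z *\<^sub>R pseudo_inverse M z) (\<integral>x. x \<partial>M)"
proof -
  let ?L = "restrict_space lborel {0<..<measure M UNIV}"
  have "integrable ?L (pseudo_inverse M)"
    using assms integrable_distr[OF pseudo_inverse_measurable, of "\<lambda>x. x"]
    unfolding distr_pseudo_inverse by blast
  moreover have "(\<integral>z. pseudo_inverse M z \<partial>?L) = (\<integral>x. x \<partial>M)"
    using integral_distr[OF pseudo_inverse_measurable, of "\<lambda>x. x"]
    unfolding distr_pseudo_inverse by simp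
  ultimately have "has_bochner_integral ?L (pseudo_inverse M) (\<integral>x. x \<partial>M)"
    by (simp add: has_bochner_integral_iff)
  then have *: "has_bochner_integral lborel
      (\<lambda>z. indicator {0<..<measure M UNIV} z *\<^sub>R pseudo_inverse M z) (\<integral>x. x \<partial>M)"
    unfolding has_bochner_integral_iff
    by (simp add: integrable_restrict_space integral_restrict_space)
  \<comment> \<open>Attraction and repulsion integrate over intervals closed at 0, the transport
    over open ones. The integrands differ at most at the point 0, which affects neither
    measurability nor the integral.\<close>
  have "(\<lambda>z. indicator {0..<measure M UNIV} z *\<^sub>R pseudo_inverse M z) \<in> borel_measurable lborel"
    by (rule measurable_discrete_difference[OF borel_measurable_has_bochner_integral[OF *],
          where X = "{0}"]) (auto simp: indicator_def)
  moreover have "AE z in lborel. indicator {0<..<measure M UNIV} z *\<^sub>R pseudo_inverse M z =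
      indicator {0..<measure M UNIV} z *\<^sub>R pseudo_inverse M z"
    using AE_lborel_singleton[of 0] by eventually_elim (auto simp: indicator_def)
  ultimately show ?thesis
    using has_bochner_integral_cong_AE[OF borel_measurable_has_bochner_integral[OF *]] * by blast
qed

text \<open>For exponent 2 the force \<open>2 * (x - y)\<close> is affine in \<open>y\<close>, so
  both interaction integrals have this form and depend on the measure only through its mass and
  first moment.\<close>

lemma set_integral_affine_pseudo_inverse:
  assumes "integrable M (\<lambda>x. x)"
  shows "(LINT \<zeta>:{0..<measure M UNIV}|lborel. a + c * pseudo_inverse M \<zeta>)
    = a * measure M UNIV + c * (\<integral>x. x \<partial>M)"
proof -
  let ?I = "\<lambda>z. indicat_real {0..<measure M UNIV} z"
  have "has_bochner_integral lborel ?I (measure M UNIV)"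
    using has_bochner_integral_real_indicator[of "{0..<measure M UNIV}" lborel] by simp
  then have "has_bochner_integral lborel
      (\<lambda>z. a * ?I z + c * (?I z *\<^sub>R pseudo_inverse M z))
      (a * measure M UNIV + c * (\<integral>x. x \<partial>M))"
    by (intro has_bochner_integral_add has_bochner_integral_mult_right
        has_bochner_integral_pseudo_inverse assms)
  moreover have "(\<lambda>z. a * ?I z + c * (?I z *\<^sub>R pseudo_inverse M z))
      = (\<lambda>z. ?I z *\<^sub>R (a + c * pseudo_inverse M z))"
    by (auto simp: algebra_simps)
  ultimately show ?thesis
    unfolding set_lebesgue_integral_def by (simp add: has_bochner_integral_integral_eq)
qed

end

subsection \<open>The affine flow\<close>

lemma transient_solution_affine:
  fixes m :: real and \<omega> :: "real measure" and \<mu> :: "real \<Rightarrow> real measure"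
  defines "b \<equiv> \<integral>x. x \<partial>\<omega>" and "M \<equiv> (\<lambda>t. \<integral>x. x \<partial>\<mu> t)"
  assumes \<omega>: "has_Linf_c_density \<omega>" and m: "m = measure \<omega> UNIV" "m > 0"
    and sol: "transient_solution 2 2 \<omega> \<mu>" and t: "t \<ge> 0"
  shows transient_solution_mean: "M t = b / m + exp (- 2 * m * t) * (M 0 - b / m)"
    and transient_solution_distr:
      "\<mu> t = distr (\<mu> 0) borel (\<lambda>x. M t + exp (- 2 * (m - 1) * t) * (x - M 0))"
proof -
  have dist: "real_distribution (\<mu> t)" if "t \<ge> 0" for t
    using sol that by (auto simp: transient_solution_def P2_def)
  have fin: "finite_borel_measure (\<mu> t)" if "t \<ge> 0" for t
    using dist[OF that] by (rule real_distribution.finite_borel_measure_M)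
  have mass: "measure (\<mu> t) UNIV = 1" if "t \<ge> 0" for t
    using prob_space.prob_space[OF real_distribution.axioms(1)[OF dist[OF that]]]
      real_distribution.space_eq_univ[OF dist[OF that]] by simp
  have int: "integrable (\<mu> t) (\<lambda>x. x)" if "t \<ge> 0" for t
    using sol that by (auto simp: transient_solution_def intro: has_Linf_c_density_imp_integrable)
  define X where "X t z = pseudo_inverse (\<mu> t) z" for t z
  have att: "attraction 2 \<omega> (\<mu> t) z = 2 * m * X t z - 2 * b" for t z
  proof -
    have "attraction 2 \<omega> (\<mu> t) z =
        (LINT \<zeta>:{0..<m}|lborel. 2 * X t z + (- 2) * pseudo_inverse \<omega> \<zeta>)"
      by (simp add: attraction_def Let_def deriv_psi_2 m X_def algebra_simps)
    also have "\<dots> = 2 * X t z * m + (- 2) * b"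
      unfolding b_def m(1) using \<omega>
      by (intro finite_borel_measure.set_integral_affine_pseudo_inverse
          has_Linf_c_density_imp_finite has_Linf_c_density_imp_integrable)
    finally show ?thesis by simp
  qed
  have rep: "repulsion 2 (\<mu> t) z = 2 * X t z - 2 * M t" if t: "t \<ge> 0" for t z
  proof -
    have "repulsion 2 (\<mu> t) z =
        (LINT \<zeta>:{0..<measure (\<mu> t) UNIV}|lborel. 2 * X t z + (- 2) * pseudo_inverse (\<mu> t) \<zeta>)"
      by (simp add: repulsion_def deriv_psi_2 X_def mass[OF t] algebra_simps)
    also have "\<dots> = 2 * X t z * measure (\<mu> t) UNIV + (- 2) * M t"
      unfolding M_def
      by (intro finite_borel_measure.set_integral_affine_pseudo_inverse fin int t)
    finally show ?thesis by (simp add: mass[OF t])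
  qed
  have ode: "((\<lambda>s. X s z) has_real_derivative - (2 * (m - 1)) * X t z + 2 * b - 2 * M t)
      (at t within {0..})" if "t \<ge> 0" "z \<in> {0..<1}" for t z
  proof -
    have "((\<lambda>s. X s z) has_real_derivative
        - attraction 2 \<omega> (\<mu> t) z + repulsion 2 (\<mu> t) z) (at t within {0..})"
      using sol that unfolding transient_solution_def X_def by blast
    then show ?thesis
      by (simp add: att rep[OF that(1)] algebra_simps)
  qed
  define e where "e t = exp (- (2 * (m - 1)) * t)" for t
  \<comment> \<open>The terms \<open>2 * b - 2 * M t\<close> are the same for all \<open>z\<close>
    and cancel in the difference with the reference level 0, leaving a homogeneous linear
    equation.\<close>
  have X_eq: "X t z = X t 0 + e t * (X 0 z - X 0 0)" if "t \<ge> 0" "z \<in> {0..<1}" for t z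
  proof -
    have "X t z - X t 0 = exp (- (2 * (m - 1)) * t) * (X 0 z - X 0 0)"
    proof (rule linear_ode_solution[where y = "\<lambda>t. X t z - X t 0"])
      fix t :: real assume "t \<ge> 0"
      then show "((\<lambda>t. X t z - X t 0) has_real_derivative
          - (2 * (m - 1)) * (X t z - X t 0)) (at t within {0..})"
        using that ode[of t z] ode[of t 0]
        by (auto intro!: derivative_eq_intros simp: algebra_simps)
    qed (use that in simp)
    then show ?thesis by (simp add: e_def)
  qed
  \<comment> \<open>Integrating \<open>X_eq\<close> over the levels in \<open>{0..<1}\<close>
    replaces \<open>X\<close> by its mean.\<close>
  have M_eq: "M t = X t 0 + e t * (M 0 - X 0 0)" if t: "t \<ge> 0" for t
  proof -
    have set_int: "(LINT \<zeta>:{0..<1}|lborel. a + c * X t \<zeta>) = a + c * M t" if "t \<ge> 0" for t a c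
      using finite_borel_measure.set_integral_affine_pseudo_inverse[OF fin[OF that] int[OF that]]
      by (simp add: mass[OF that] X_def M_def)
    have "M t = (LINT \<zeta>:{0..<1}|lborel. X t \<zeta>)"
      using set_int[OF t, of 0 1] by simp
    also have "\<dots> = (LINT \<zeta>:{0..<1}|lborel. (X t 0 - e t * X 0 0) + e t * X 0 \<zeta>)"
    proof (rule set_lebesgue_integral_cong)
      show "\<forall>\<zeta>. \<zeta> \<in> {0..<1} \<longrightarrow> X t \<zeta> = (X t 0 - e t * X 0 0) + e t * X 0 \<zeta>"
      proof (intro allI impI)
        fix \<zeta> :: real assume "\<zeta> \<in> {0..<1}"
        from X_eq[OF t this] show "X t \<zeta> = (X t 0 - e t * X 0 0) + e t * X 0 \<zeta>"
          by (simp add: algebra_simps)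
      qed
    qed simp
    also have "\<dots> = X t 0 + e t * (M 0 - X 0 0)"
      by (subst set_int) (simp_all add: algebra_simps)
    finally show ?thesis .
  qed
  \<comment> \<open>By \<open>M_eq\<close>, \<open>M\<close> is an explicit combination of
    \<open>X t 0\<close> and \<open>e t\<close>, so its derivative needs no differentiation under
    the integral. The equation becomes \<open>M' = - 2 * (m - 1) * M + 2 * b - 2 * M\<close>, in
    which the repulsion cancels.\<close>
  have "M t - b / m = exp (- (2 * m) * t) * (M 0 - b / m)"
  proof (rule linear_ode_solution[where y = "\<lambda>t. M t - b / m", OF _ t])
    fix t :: real assume t: "t \<ge> 0"
    have "(e has_real_derivative - (2 * (m - 1)) * e t) (at t within {0..})"
      unfolding e_def by (auto intro!: derivative_eq_intros)
    then have "((\<lambda>t. X t 0 + e t * (M 0 - X 0 0)) has_real_derivative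
        (- (2 * (m - 1)) * X t 0 + 2 * b - 2 * M t) + (- (2 * (m - 1)) * e t) * (M 0 - X 0 0))
        (at t within {0..})"
      by (intro DERIV_add ode DERIV_cmult_right) (use t in auto)
    also have "(- (2 * (m - 1)) * X t 0 + 2 * b - 2 * M t)
        + (- (2 * (m - 1)) * e t) * (M 0 - X 0 0)
        = - (2 * (m - 1)) * (X t 0 + e t * (M 0 - X 0 0)) + 2 * b - 2 * M t"
      by (simp add: algebra_simps)
    also have "- (2 * (m - 1)) * (X t 0 + e t * (M 0 - X 0 0)) + 2 * b - 2 * M t
        = - (2 * m) * (M t - b / m)"
      unfolding M_eq[OF t, symmetric] using \<open>m > 0\<close> by (simp add: algebra_simps)
    finally have "(M has_real_derivative - (2 * m) * (M t - b / m)) (at t within {0..})"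
    proof (rule has_field_derivative_transform_within[where d = 1])
      fix s :: real assume "s \<in> {0..}"
      then show "X s 0 + e s * (M 0 - X 0 0) = M s"
        by (intro M_eq[symmetric]) simp
    qed (use t in simp_all)
    from DERIV_diff[OF this DERIV_const[of "b / m"]]
    show "((\<lambda>t. M t - b / m) has_real_derivative - (2 * m) * (M t - b / m)) (at t within {0..})"
      by simp
  qed
  then show "M t = b / m + exp (- 2 * m * t) * (M 0 - b / m)"
    by simp
  let ?L = "restrict_space lborel {0<..<1::real}"
  have transport: "distr ?L borel (X t) = \<mu> t" and Xm: "X t \<in> borel_measurable ?L"
    if "t \<ge> 0" for t
    using finite_borel_measure.distr_pseudo_inverse[OF fin[OF that]]
      finite_borel_measure.pseudo_inverse_measurable[OF fin[OF that]]
    by (simp_all add: mass[OF that] X_def[abs_def])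
  have "\<mu> t = distr ?L borel (X t)"
    using transport[OF t] by simp
  \<comment> \<open>Eliminating \<open>X t 0\<close> between \<open>X_eq\<close> and
    \<open>M_eq\<close> gives \<open>X t z - M t = e t * (X 0 z - M 0)\<close>: an affine map acts
    on the values of the pseudo-inverse, hence by image on the measure.\<close>
  also have "\<dots> = distr ?L borel ((\<lambda>x. M t + e t * (x - M 0)) \<circ> X 0)"
  proof (rule distr_cong)
    fix z assume "z \<in> space ?L"
    then have "z \<in> {0..<1}" by (simp add: space_restrict_space)
    from X_eq[OF t this] M_eq[OF t] show "X t z = ((\<lambda>x. M t + e t * (x - M 0)) \<circ> X 0) z"
      by (simp add: algebra_simps)
  qed simp_all
  also have "\<dots> = distr (distr ?L borel (X 0)) borel (\<lambda>x. M t + e t * (x - M 0))"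
    by (rule distr_distr[symmetric]) (use Xm[of 0] in auto)
  finally show "\<mu> t = distr (\<mu> 0) borel (\<lambda>x. M t + exp (- 2 * (m - 1) * t) * (x - M 0))"
    by (simp add: transport e_def)
qed

section \<open>Long-time behaviour in the three mass regimes\<close>

theorem theorem4p2:
  fixes qa qr m :: real
    and \<omega> \<mu>0 :: "real measure"
    and \<mu> :: "real \<Rightarrow> real measure"
  assumes "qa = 2" and "qr = 2"
    and "has_Linf_c_density \<omega>"
    and "m = measure \<omega> UNIV" and "m > 0"
    and "transient_solution qa qr \<omega> \<mu>"
    and "\<mu> 0 = \<mu>0"
  shows "(m > 1 \<longrightarrow> narrow_limit \<mu> (return borel ((1 / m) * (\<integral>x. x \<partial>\<omega>))) at_top) \<and>
    (0 < m \<and> m < 1 \<longrightarrow> vague_limit \<mu> (null_measure borel) at_top) \<and>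
    (m = 1 \<longrightarrow>
      (\<forall>t\<ge>0. is_translate (\<mu> t) \<mu>0) \<and>
      (\<exists>C. \<forall>t\<ge>0. \<bar>(\<integral>x. x \<partial>\<mu> t) - (1 / m) * (\<integral>x. x \<partial>\<omega>)\<bar> \<le> C * exp (- 2 * m * t)))"
proof -
  have \<omega>: "has_Linf_c_density \<omega>" and m: "m = measure \<omega> UNIV" "m > 0"
    and sol: "transient_solution 2 2 \<omega> \<mu>"
    using assms by auto
  define b where "b = (\<integral>x. x \<partial>\<omega>)"
  define M where "M t = (\<integral>x. x \<partial>\<mu> t)" for t
  define T where "T t x = M t + exp (- 2 * (m - 1) * t) * (x - M 0)" for t x
  have mean: "M t = b / m + exp (- 2 * m * t) * (M 0 - b / m)"
    and flow: "\<mu> t = distr (\<mu> 0) borel (T t)" if "t \<ge> 0" for t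
    using transient_solution_mean[OF \<omega> m sol that] transient_solution_distr[OF \<omega> m sol that]
    by (simp_all add: M_def b_def T_def[abs_def])
  interpret \<mu>0: real_distribution "\<mu> 0"
    using sol by (auto simp: transient_solution_def P2_def)
  have Tm: "T t \<in> borel_measurable borel" for t
    unfolding T_def by measurable
  have exp_mt: "((\<lambda>t. exp (- 2 * k * t)) \<longlongrightarrow> 0) at_top" if "k > 0" for k :: real
    using that
    by (intro filterlim_compose[OF exp_at_bot] filterlim_ident
        filterlim_tendsto_neg_mult_at_bot[OF tendsto_const]) simp
  have M_lim: "(M \<longlongrightarrow> b / m) at_top"
  proof -
    have "((\<lambda>t. b / m + exp (- 2 * m * t) * (M 0 - b / m)) \<longlongrightarrow> b / m + 0 * (M 0 - b / m)) at_top"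
      by (intro tendsto_intros exp_mt m)
    moreover have "\<forall>\<^sub>F t in at_top. b / m + exp (- 2 * m * t) * (M 0 - b / m) = M t"
      using eventually_ge_at_top[of 0] by eventually_elim (rule mean[symmetric])
    ultimately have "(M \<longlongrightarrow> b / m + 0 * (M 0 - b / m)) at_top"
      by (rule Lim_transform_eventually)
    then show ?thesis by simp
  qed
  \<comment> \<open>Both limits reduce to pointwise convergence along the flow: the integral is
    pulled back to the fixed probability measure \<open>\<mu> 0\<close>, where a bound of
    \<open>f\<close> is an integrable dominating function.\<close>
  have lim: "((\<lambda>t. \<integral>x. f x \<partial>\<mu> t) \<longlongrightarrow> l) at_top"
    if f: "continuous_on UNIV f" "bounded (range f)"
      and pt: "AE x in \<mu> 0. ((\<lambda>t. f (T t x)) \<longlongrightarrow> l) at_top" for f :: "real \<Rightarrow> real" and l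
  proof -
    have fm: "f \<in> borel_measurable borel"
      using f(1) by (rule borel_measurable_continuous_onI)
    obtain B where B: "\<And>x. \<bar>f x\<bar> \<le> B"
      using f(2) by (auto simp: bounded_iff)
    have "((\<lambda>t. \<integral>x. f (T t x) \<partial>\<mu> 0) \<longlongrightarrow> (\<integral>x. l \<partial>\<mu> 0)) at_top"
      by (rule integral_dominated_convergence_at_top[where w = "\<lambda>_. B"])
         (use B pt measurable_compose[OF Tm fm] in auto)
    then have "((\<lambda>t. \<integral>x. f (T t x) \<partial>\<mu> 0) \<longlongrightarrow> l) at_top"
      using \<mu>0.prob_space by simp
    moreover have "\<forall>\<^sub>F t in at_top. (\<integral>x. f (T t x) \<partial>\<mu> 0) = (\<integral>x. f x \<partial>\<mu> t)"
      using eventually_ge_at_top[of 0]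
    proof eventually_elim
      case (elim t)
      show ?case
        by (subst flow[OF elim], subst integral_distr) (use Tm fm in auto)
    qed
    ultimately show ?thesis
      by (rule Lim_transform_eventually)
  qed
  have "narrow_limit \<mu> (return borel (1 / m * (\<integral>x. x \<partial>\<omega>))) at_top" if "m > 1"
    unfolding narrow_limit_def
  proof (intro allI impI)
    fix f :: "real \<Rightarrow> real" assume f: "continuous_on UNIV f \<and> bounded (range f)"
    have "((\<lambda>t. f (T t x)) \<longlongrightarrow> f (b / m)) at_top" for x
    proof (rule isCont_tendsto_compose[where g = f and l = "b / m"])
      show "isCont f (b / m)"
        using f by (simp add: continuous_on_eq_continuous_at)
      have "((\<lambda>t. T t x) \<longlongrightarrow> b / m + 0 * (x - M 0)) at_top"
        unfolding T_def using that
        by (intro tendsto_add tendsto_mult tendsto_const M_lim exp_mt) simp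
      then show "((\<lambda>t. T t x) \<longlongrightarrow> b / m) at_top" by simp
    qed
    then have "((\<lambda>t. \<integral>x. f x \<partial>\<mu> t) \<longlongrightarrow> f (b / m)) at_top"
      using f by (intro lim) auto
    moreover have "(\<integral>x. f x \<partial>return borel (1 / m * (\<integral>x. x \<partial>\<omega>))) = f (b / m)"
      using f by (subst integral_return)
        (auto simp: b_def intro: borel_measurable_continuous_onI)
    ultimately show "((\<lambda>t. \<integral>x. f x \<partial>\<mu> t) \<longlongrightarrow>
        (\<integral>x. f x \<partial>return borel (1 / m * (\<integral>x. x \<partial>\<omega>)))) at_top"
      by simp
  qed
  moreover have "vague_limit \<mu> (null_measure borel) at_top" if "m < 1"
    unfolding vague_limit_def
  proof (intro allI impI)
    fix f :: "real \<Rightarrow> real"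
    assume "continuous_on UNIV f \<and> (\<exists>K. compact K \<and> (\<forall>x. x \<notin> K \<longrightarrow> f x = 0))"
    then obtain K where f: "continuous_on UNIV f" and K: "compact K" "\<And>x. x \<notin> K \<Longrightarrow> f x = 0"
      by blast
    obtain R where R: "\<And>x. x \<in> K \<Longrightarrow> \<bar>x\<bar> \<le> R"
      using compact_imp_bounded[OF K(1)] by (auto simp: bounded_iff)
    have "compact (f ` K)"
      using f K(1) compact_continuous_image continuous_on_subset by blast
    \<comment> \<open>The inserted 0 is the value of \<open>f\<close> off \<open>K\<close>.\<close>
    then have "bounded (insert 0 (f ` K))"
      by (simp add: compact_imp_bounded)
    then have bdd: "bounded (range f)"
      by (rule bounded_subset) (use K(2) in auto)
    \<comment> \<open>For \<open>m < 1\<close> the offset \<open>x - M 0\<close> is multiplied by a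
      growing exponential while \<open>M\<close> stays convergent, so every trajectory not starting
      at \<open>M 0\<close> eventually leaves \<open>K\<close>.\<close>
    have "((\<lambda>t. f (T t x)) \<longlongrightarrow> 0) at_top" if x: "x \<noteq> M 0" for x
    proof (rule tendsto_eventually)
      have "filterlim (\<lambda>t. exp (- 2 * (m - 1) * t)) at_top at_top"
        using \<open>m < 1\<close>
        by (intro filterlim_compose[OF exp_at_top] filterlim_ident
            filterlim_tendsto_pos_mult_at_top[OF tendsto_const]) simp
      then have "filterlim (\<lambda>t. (x - M 0) * exp (- 2 * (m - 1) * t)) at_infinity at_top"
        using x by (intro tendsto_mult_filterlim_at_infinity[OF tendsto_const]
            filterlim_at_top_imp_at_infinity) auto
      then have "filterlim (\<lambda>t. T t x) at_infinity at_top"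
        unfolding T_def mult.commute[of _ "x - M 0"]
        by (rule tendsto_add_filterlim_at_infinity[OF M_lim])
      \<comment> \<open>The radius \<open>\<bar>R\<bar> + 1\<close> is positive and exceeds
        \<open>R\<close>, even if \<open>K\<close> is empty and \<open>R\<close> negative.\<close>
      then have "\<forall>\<^sub>F t in at_top. \<bar>R\<bar> + 1 \<le> norm (T t x)"
        by (simp add: filterlim_at_infinity[of 0])
      then show "\<forall>\<^sub>F t in at_top. f (T t x) = 0"
      proof eventually_elim
        case (elim t)
        then have "T t x \<notin> K" using R[of "T t x"] by auto
        then show ?case by (rule K(2))
      qed
    qed
    moreover have "has_Linf_c_density (\<mu> 0)"
      using sol by (auto simp: transient_solution_def)
    ultimately have "((\<lambda>t. \<integral>x. f x \<partial>\<mu> t) \<longlongrightarrow> 0) at_top"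
      using has_Linf_c_density_imp_diffuse[of "\<mu> 0" "M 0"]
      by (intro lim f bdd) (auto elim!: eventually_mono)
    then show "((\<lambda>t. \<integral>x. f x \<partial>\<mu> t) \<longlongrightarrow> (\<integral>x. f x \<partial>null_measure borel)) at_top"
      by simp
  qed
  moreover have "is_translate (\<mu> t) \<mu>0" if "m = 1" "t \<ge> 0" for t
  proof -
    have "T t = (\<lambda>x. x + (M t - M 0))"
      using that by (auto simp: T_def)
    then show ?thesis
      using flow[OF that(2)] assms(7) unfolding is_translate_def by auto
  qed
  \<comment> \<open>The formula \<open>mean\<close> yields equality, with the initial distance
    between the two centers as the constant.\<close>
  moreover have "\<exists>C. \<forall>t\<ge>0. \<bar>(\<integral>x. x \<partial>\<mu> t) - (1 / m) * (\<integral>x. x \<partial>\<omega>)\<bar> \<le> C * exp (- 2 * m * t)"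
  proof (intro exI allI impI)
    fix t :: real assume "t \<ge> 0"
    then show "\<bar>(\<integral>x. x \<partial>\<mu> t) - (1 / m) * (\<integral>x. x \<partial>\<omega>)\<bar>
        \<le> \<bar>M 0 - b / m\<bar> * exp (- 2 * m * t)"
      using mean[of t] by (simp add: M_def b_def abs_mult)
  qed
  ultimately show ?thesis by blast
qed

end
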